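(* Let $G=(V,E)$ be a finite simple undirected graph, let $\mathcal{G}=(\mathcal{V},\mathcal{E})$ be a lossless summary of $G$, and for $u\in V$ let $S(u)$ be the supernode containing $u$. Let $P^i(u)$ be the Pagerank iteration on $G$: $P^0(u)=1$ and $P^i(u)=\sum_{w\in N(u)}P^{i-1}(w)/|N(w)|$ for $i\ge1$. For a supernode $X$ let $N(X)$ be the set of supernodes $Y$ (possibly $Y=X$) with $\{X,Y\}\in\mathcal{E}$, $N^-(X)=N(X)\setminus\{X\}$, and call $X$ a clique if $X\in N(X)$ and an independent set otherwise. Put $W(X)=\sum_{Y\in N^-(X)}|Y|$ if $X$ is an independent set and $W(X)=\sum_{Y\in N^-(X)}|Y|+(|X|-1)$ if $X$ is a clique. Define the summary iteration by $P^0(X)=|X|$ and, for $i\ge1$, $P^i(X)=\sum_{Y\in N^-(X)}\frac{|X|\,P^{i-1}(Y)}{W(Y)}$ if $X$ is an independent set, and $P^i(X)=\sum_{Y\in N^-(X)}\frac{|X|\,P^{i-1}(Y)}{W(Y)}+\frac{(|X|-1)\,P^{i-1}(X)}{W(X)}$ if $X$ is a clique. Then for every $i\ge0$ and every $u\in V$, $P^i(u)=P^i(S(u))/|S(u)|$. Consequently, running the summary iteration until $P^i(X)=P^{i-1}(X)$ for all $X\in\mathcal{V}$ and outputting $P^i(S(u))/|S(u)|$ for each $u\in V$ yields exactly the same Pagerank scores as running the Pagerank iteration on $G$ until $P^i=P^{i-1}$.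
   Context: $N(u)$ is the set of neighbours of $u$ in $G$. A summary of $G$ is a pair $(\mathcal{V},\mathcal{E})$ where $\mathcal{V}$ is a partition of $V$ into nonempty sets (supernodes) and $\mathcal{E}$ a set of unordered pairs $\{S_i,S_j\}$ of supernodes ($i=j$ allowed, a self-loop), called superedges. Its reconstruction is the simple graph on $V$ containing, for each superedge $\{S_i,S_j\}$ with $i\neq j$, all pairs $\{u,w\}$ with $u\in S_i, w\in S_j$, and for each self-loop $\{S_i,S_i\}$, all pairs of distinct nodes of $S_i$. The summary is lossless if its reconstruction equals $G$. *)

theory Defs
  imports Complex_Main "HOL-Library.Disjoint_Sets" "HOL-Library.FuncSet"
    "HOL-Library.While_Combinator"
begin

definition simple_graph :: "'a set \<Rightarrow> 'a set set \<Rightarrow> bool" where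
  "simple_graph V E \<longleftrightarrow> finite V \<and> E \<subseteq> {{u, w} | u w. u \<in> V \<and> w \<in> V \<and> u \<noteq> w}"

text \<open>Neighbourhood with respect to a set of unordered pairs, used both for graphs and for
  summaries. A self-loop at \<open>x\<close> is the pair \<open>{x, x} = {x}\<close>, so \<open>x \<in> nbrs F x\<close> iff
  \<open>{x} \<in> F\<close>.\<close>

definition nbrs :: "'b set set \<Rightarrow> 'b \<Rightarrow> 'b set" where
  "nbrs F x = {y. {x, y} \<in> F}"

definition is_summary :: "'a set \<Rightarrow> 'a set set \<Rightarrow> 'a set set set \<Rightarrow> bool" where
  "is_summary V \<V> \<E> \<longleftrightarrow> partition_on V \<V> \<and> \<E> \<subseteq> {{X, Y} | X Y. X \<in> \<V> \<and> Y \<in> \<V>}"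

definition reconstruction :: "'a set set set \<Rightarrow> 'a set set" where
  "reconstruction \<E> =
     {{u, w} | u w X Y. {X, Y} \<in> \<E> \<and> X \<noteq> Y \<and> u \<in> X \<and> w \<in> Y} \<union>
     {{u, w} | u w X. {X, X} \<in> \<E> \<and> u \<in> X \<and> w \<in> X \<and> u \<noteq> w}"

definition lossless_summary :: "'a set \<Rightarrow> 'a set set \<Rightarrow> 'a set set \<Rightarrow> 'a set set set \<Rightarrow> bool" where
  "lossless_summary V E \<V> \<E> \<longleftrightarrow> is_summary V \<V> \<E> \<and> reconstruction \<E> = E"

definition supernode :: "'a set set \<Rightarrow> 'a \<Rightarrow> 'a set" where
  "supernode \<V> u = (THE X. X \<in> \<V> \<and> u \<in> X)"

primrec pagerank :: "'a set set \<Rightarrow> nat \<Rightarrow> 'a \<Rightarrow> real" where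
  "pagerank E 0 u = 1"
| "pagerank E (Suc i) u = (\<Sum>w\<in>nbrs E u. pagerank E i w / real (card (nbrs E w)))"

definition nbrs_minus :: "'a set set set \<Rightarrow> 'a set \<Rightarrow> 'a set set" where
  "nbrs_minus \<E> X = nbrs \<E> X - {X}"

definition is_clique :: "'a set set set \<Rightarrow> 'a set \<Rightarrow> bool" where
  "is_clique \<E> X \<longleftrightarrow> X \<in> nbrs \<E> X"

definition weight :: "'a set set set \<Rightarrow> 'a set \<Rightarrow> real" where
  "weight \<E> X =
     (if is_clique \<E> X
      then (\<Sum>Y\<in>nbrs_minus \<E> X. real (card Y)) + (real (card X) - 1)
      else (\<Sum>Y\<in>nbrs_minus \<E> X. real (card Y)))"

text \<open>In a lossless summary the only possible division by zero below is in the last term, for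
  a singleton supernode whose sole superedge is a self-loop; there the numerator
  \<open>card X - 1\<close> vanishes too, and the term is \<open>0 / 0 = 0\<close>.\<close>

primrec summary_pagerank :: "'a set set set \<Rightarrow> nat \<Rightarrow> 'a set \<Rightarrow> real" where
  "summary_pagerank \<E> 0 X = real (card X)"
| "summary_pagerank \<E> (Suc i) X =
     (if is_clique \<E> X
      then (\<Sum>Y\<in>nbrs_minus \<E> X. real (card X) * summary_pagerank \<E> i Y / weight \<E> Y)
           + (real (card X) - 1) * summary_pagerank \<E> i X / weight \<E> X
      else (\<Sum>Y\<in>nbrs_minus \<E> X. real (card X) * summary_pagerank \<E> i Y / weight \<E> Y))"

text \<open>Run an iteration \<open>p 0, p 1, \<dots>\<close> of vectors indexed by \<open>A\<close> until \<open>p i = p (i - 1)\<close> on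
  \<open>A\<close>, starting with the test at \<open>i = 1\<close>, and return the last \<open>p i\<close>; the result is \<open>None\<close>
  iff the loop does not terminate.\<close>

definition run_until_stable :: "'b set \<Rightarrow> (nat \<Rightarrow> 'b \<Rightarrow> real) \<Rightarrow> ('b \<Rightarrow> real) option" where
  "run_until_stable A p =
     map_option p (while_option (\<lambda>i. \<not> (\<forall>x\<in>A. p i x = p (i - 1) x)) Suc 1)"

definition pagerank_scores :: "'a set \<Rightarrow> 'a set set \<Rightarrow> ('a \<Rightarrow> real) option" where
  "pagerank_scores V E =
     map_option (\<lambda>p. \<lambda>u\<in>V. p u) (run_until_stable V (pagerank E))"

definition summary_pagerank_scores ::
    "'a set \<Rightarrow> 'a set set \<Rightarrow> 'a set set set \<Rightarrow> ('a \<Rightarrow> real) option" where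
  "summary_pagerank_scores V \<V> \<E> =
     map_option (\<lambda>p. \<lambda>u\<in>V. p (supernode \<V> u) / real (card (supernode \<V> u)))
       (run_until_stable \<V> (summary_pagerank \<E>))"

end

theory Submission
  imports Defs
begin

text \<open>In a lossless summary the neighbourhood of a vertex \<open>u\<close> in a supernode \<open>X\<close> is the union of
  the supernodes adjacent to \<open>X\<close>, together with \<open>X - {u}\<close> if \<open>X\<close> is a clique. Hence a sum over
  neighbours of a function that is constant on supernodes collapses to a sum over supernodes
  weighted by their sizes; for the constant \<open>1\<close> this shows that degrees are the weights \<open>W\<close>.\<close>

lemma supernode_eq:
  assumes "partition_on V \<V>" "X \<in> \<V>" "u \<in> X"
  shows "supernode \<V> u = X"
  unfolding supernode_def
proof (rule the_equality)
  fix Y assume "Y \<in> \<V> \<and> u \<in> Y"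
  then show "Y = X"
    using assms(2,3) disjointD[OF partition_onD2[OF assms(1)], of Y X] by blast
qed (use assms in blast)

lemma nbrs_minus_subset:
  assumes "is_summary V \<V> \<E>"
  shows "nbrs_minus \<E> X \<subseteq> \<V>"
  using assms by (fastforce simp: nbrs_minus_def nbrs_def is_summary_def doubleton_eq_iff)

lemma nbrs_reconstruction:
  assumes summary: "is_summary V \<V> \<E>" and X: "X \<in> \<V>" "u \<in> X"
  shows "nbrs (reconstruction \<E>) u =
    \<Union> (nbrs_minus \<E> X) \<union> (if is_clique \<E> X then X - {u} else {})" (is "_ = ?N")
proof (intro set_eqI)
  fix w
  \<comment> \<open>Distinct supernodes are disjoint, so a superedge end containing \<open>u\<close>
    can only be \<open>X\<close>. This removes the quantifier over that end below.\<close>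
  have super: "Y = X" if "{Y, Z} \<in> \<E>" "u \<in> Y" for Y Z
  proof -
    have "Y \<in> \<V>"
      using that summary by (fastforce simp: is_summary_def doubleton_eq_iff)
    then show ?thesis
      using disjointD[OF partition_onD2, of V \<V> Y X] summary X that(2)
      by (auto simp: is_summary_def)
  qed
  \<comment> \<open>A pair \<open>{u, w}\<close> may match the generating pair in either order; the
    reversed match is absorbed by swapping the ends of the superedge.\<close>
  have "w \<in> nbrs (reconstruction \<E>) u \<longleftrightarrow>
    (\<exists>Y Z. {Y, Z} \<in> \<E> \<and> Y \<noteq> Z \<and> u \<in> Y \<and> w \<in> Z) \<or>
    (\<exists>Y. {Y, Y} \<in> \<E> \<and> u \<in> Y \<and> w \<in> Y \<and> u \<noteq> w)"
    unfolding nbrs_def reconstruction_def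
    by (auto simp: doubleton_eq_iff) (metis insert_commute)+
  also have "\<dots> \<longleftrightarrow> (\<exists>Z. {X, Z} \<in> \<E> \<and> X \<noteq> Z \<and> w \<in> Z) \<or> ({X, X} \<in> \<E> \<and> w \<in> X \<and> u \<noteq> w)"
    using super X(2) by metis
  also have "\<dots> \<longleftrightarrow> w \<in> ?N"
    by (auto simp: nbrs_minus_def nbrs_def is_clique_def)
  finally show "w \<in> nbrs (reconstruction \<E>) u \<longleftrightarrow> w \<in> ?N" .
qed

lemma sum_nbrs_reconstruction:
  fixes f :: "'a \<Rightarrow> real"
  assumes "finite V" and summary: "is_summary V \<V> \<E>" and X: "X \<in> \<V>" "u \<in> X"
    and f: "\<And>Y w. Y \<in> \<V> \<Longrightarrow> w \<in> Y \<Longrightarrow> f w = g Y"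
  shows "(\<Sum>w\<in>nbrs (reconstruction \<E>) u. f w) =
    (\<Sum>Y\<in>nbrs_minus \<E> X. real (card Y) * g Y) +
    (if is_clique \<E> X then (real (card X) - 1) * g X else 0)"
proof -
  have part: "partition_on V \<V>"
    using summary by (simp add: is_summary_def)
  have fin: "finite Y" if "Y \<in> \<V>" for Y
    using that part \<open>finite V\<close> by (metis Union_upper finite_subset partition_onD1)
  have sub: "nbrs_minus \<E> X \<subseteq> \<V>"
    using nbrs_minus_subset[OF summary] .
  have finN: "finite (nbrs_minus \<E> X)"
    using sub finite_elements[OF \<open>finite V\<close> part] by (rule finite_subset)
  have "(\<Sum>w\<in>nbrs (reconstruction \<E>) u. f w) =
    (\<Sum>w\<in>\<Union> (nbrs_minus \<E> X). f w) + (\<Sum>w\<in>(if is_clique \<E> X then X - {u} else {}). f w)"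
    unfolding nbrs_reconstruction[OF summary X]
  proof (rule sum.union_disjoint)
    show "finite (\<Union> (nbrs_minus \<E> X))"
      using finN sub fin by blast
    \<comment> \<open>\<open>nbrs_minus\<close> leaves out \<open>X\<close> itself, so the self-loop
      contributes only through \<open>X - {u}\<close> and no vertex is counted twice.\<close>
    have "Y \<inter> X = {}" if "Y \<in> nbrs_minus \<E> X" for Y
      using that sub X(1) disjointD[OF partition_onD2[OF part], of Y X]
      by (auto simp: nbrs_minus_def)
    then show "\<Union> (nbrs_minus \<E> X) \<inter> (if is_clique \<E> X then X - {u} else {}) = {}"
      by auto
  qed (use fin X in auto)
  also have "(\<Sum>w\<in>\<Union> (nbrs_minus \<E> X). f w) = (\<Sum>Y\<in>nbrs_minus \<E> X. \<Sum>w\<in>Y. f w)"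
    using sub fin disjointD[OF partition_onD2[OF part]]
    by (subst sum.Union_disjoint) (auto simp: subset_iff)
  also have "\<dots> = (\<Sum>Y\<in>nbrs_minus \<E> X. real (card Y) * g Y)"
    using sub f by (intro sum.cong) (auto simp: subset_iff)
  also have "(\<Sum>w\<in>(if is_clique \<E> X then X - {u} else {}). f w) =
    (if is_clique \<E> X then (real (card X) - 1) * g X else 0)"
  proof -
    have "(\<Sum>w\<in>X - {u}. f w) = real (card (X - {u})) * g X"
      using f X by simp
    also have "real (card (X - {u})) = real (card X) - 1"
      using card_Suc_Diff1[OF fin[OF X(1)] X(2)] by linarith
    finally show ?thesis by simp
  qed
  finally show ?thesis .
qed

lemma card_nbrs_reconstruction:
  assumes "finite V" "is_summary V \<V> \<E>" "X \<in> \<V>" "u \<in> X"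
  shows "real (card (nbrs (reconstruction \<E>) u)) = weight \<E> X"
  using sum_nbrs_reconstruction[OF assms, of "\<lambda>_. 1" "\<lambda>_. 1"] by (simp add: weight_def)

text \<open>Induction on \<open>i\<close>, simultaneously for all supernodes and their vertices: the
  induction hypothesis makes rank divided by degree constant on each supernode, which is what
  collapsing the neighbour sum requires.\<close>

lemma pagerank_reconstruction:
  assumes fin: "finite V" and summary: "is_summary V \<V> \<E>" and "X \<in> \<V>" "u \<in> X"
  shows "pagerank (reconstruction \<E>) i u = summary_pagerank \<E> i X / real (card X)"
  using assms(3,4)
proof (induction i arbitrary: X u)
  have part: "partition_on V \<V>"
    using summary by (simp add: is_summary_def)
  have card_nz: "real (card Y) \<noteq> 0" if "Y \<in> \<V>" for Y
  proof -
    have "finite Y" "Y \<noteq> {}"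
      using that part fin finite_subset[of Y V] by (auto simp: partition_on_def)
    then show ?thesis by simp
  qed
  {
    case 0
    then show ?case using card_nz by simp
  next
    case (Suc i)
    \<comment> \<open>The common value of the summand on \<open>Y\<close>: the rank from the
      induction hypothesis over the degree \<open>weight \<E> Y\<close>. If that weight is 0, both
      iterations contain the same quotient by 0, so the identities persist.\<close>
    let ?g = "\<lambda>Y. summary_pagerank \<E> i Y / real (card Y) / weight \<E> Y"
    have "pagerank (reconstruction \<E>) (Suc i) u =
      (\<Sum>Y\<in>nbrs_minus \<E> X. real (card Y) * ?g Y) +
      (if is_clique \<E> X then (real (card X) - 1) * ?g X else 0)"
      unfolding pagerank.simps using Suc.prems
      by (intro sum_nbrs_reconstruction[OF fin summary])
        (simp_all add: Suc.IH card_nbrs_reconstruction[OF fin summary])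
    also have "(\<Sum>Y\<in>nbrs_minus \<E> X. real (card Y) * ?g Y) =
      (\<Sum>Y\<in>nbrs_minus \<E> X. summary_pagerank \<E> i Y / weight \<E> Y)"
    proof (rule sum.cong)
      fix Y assume "Y \<in> nbrs_minus \<E> X"
      then have "real (card Y) \<noteq> 0"
        using card_nz nbrs_minus_subset[OF summary] by blast
      then show "real (card Y) * ?g Y = summary_pagerank \<E> i Y / weight \<E> Y"
        by simp
    qed simp
    \<comment> \<open>The factor \<open>card X\<close> of the summary iteration is inserted and
      divided out again; supernodes are nonempty, so it is not 0.\<close>
    also have "\<dots> =
      (\<Sum>Y\<in>nbrs_minus \<E> X. real (card X) * summary_pagerank \<E> i Y / weight \<E> Y) / real (card X)"
      using card_nz[OF Suc.prems(1)] by (simp add: sum_divide_distrib)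
    finally show ?case
      by (simp add: add_divide_distrib)
  }
qed

theorem theorem3p5:
  fixes V :: "'a set" and E :: "'a set set"
    and \<V> :: "'a set set" and \<E> :: "'a set set set"
  assumes "simple_graph V E"
    and "lossless_summary V E \<V> \<E>"
  shows "(\<forall>i. \<forall>u\<in>V. pagerank E i u =
            summary_pagerank \<E> i (supernode \<V> u) / real (card (supernode \<V> u)))
       \<and> summary_pagerank_scores V \<V> \<E> = pagerank_scores V E"
proof -
  have fin: "finite V"
    using assms(1) by (simp add: simple_graph_def)
  have summary: "is_summary V \<V> \<E>" and E: "E = reconstruction \<E>"
    using assms(2) by (auto simp: lossless_summary_def)
  have part: "partition_on V \<V>"
    using summary by (simp add: is_summary_def)
  have pr: "pagerank E i u = summary_pagerank \<E> i X / real (card X)"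
    if "X \<in> \<V>" "u \<in> X" for i u X
    unfolding E using pagerank_reconstruction[OF fin summary that] .
  have scores: "pagerank E i u =
      summary_pagerank \<E> i (supernode \<V> u) / real (card (supernode \<V> u))"
    if "u \<in> V" for i u
  proof -
    obtain X where "X \<in> \<V>" "u \<in> X"
      using \<open>u \<in> V\<close> partition_onD1[OF part] by blast
    then show ?thesis
      using pr supernode_eq[OF part] by simp
  qed
  \<comment> \<open>On \<open>X\<close> both ranks are constants, namely the summary values over the
    nonzero \<open>card X\<close>. Nonemptiness of \<open>X\<close> supplies the vertex for the
    forward direction.\<close>
  have eq_on_supernode: "(\<forall>u\<in>X. pagerank E i u = pagerank E j u) \<longleftrightarrow>
      summary_pagerank \<E> i X = summary_pagerank \<E> j X" if "X \<in> \<V>" for i j X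
  proof -
    have "X \<noteq> {}" "finite X"
      using that part fin finite_subset[of X V] by (auto simp: partition_on_def)
    then show ?thesis
      using that by (auto simp: pr)
  qed
  \<comment> \<open>The two stopping tests agree at every \<open>i\<close>, since the supernodes
    cover \<open>V\<close>. Both loops thus have the same condition, step and start: they halt at
    the same index or both diverge, giving \<open>None\<close>.\<close>
  have "(\<forall>u\<in>V. pagerank E i u = pagerank E (i - 1) u) \<longleftrightarrow>
      (\<forall>X\<in>\<V>. summary_pagerank \<E> i X = summary_pagerank \<E> (i - 1) X)" for i
    using eq_on_supernode partition_onD1[OF part] by auto
  then have "summary_pagerank_scores V \<V> \<E> = pagerank_scores V E"
    unfolding summary_pagerank_scores_def pagerank_scores_def run_until_stable_def
    \<comment> \<open>With equal loops, only the output at the common index remains; both outputs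
      are restricted to \<open>V\<close>, where \<open>scores\<close> identifies them.\<close>
    by (auto simp: option.map_comp comp_def scores intro!: option.map_cong restrict_ext)
  with scores show ?thesis by blast
qed

end
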